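(* Let $n$ be a positive integer and consider double paths on vertex set $[n]$. (A) If $n\ge 3$ and $\mathcal L=\{1,n\}$, then $\overrightarrow{P}_{n,\mathcal L}$ does not require the nSSP but allows the nSSP, and $\overrightarrow{P}_{n,[n]\setminus\mathcal L}$ does not require the nSSP. (B) If $n$ is even, then $\overrightarrow{P}_{n,\{2\}}$ requires the nSSP. (C) Let $n\ge 3$ be odd. (a) If $\mathcal L=\{\frac{n+1}{2}\}$, then $\overrightarrow{P}_{n,\mathcal L}$ does not require the nSSP. (b) If $\mathcal L=[n]\setminus\{\frac{n+1}{2}\}$, then $\overrightarrow{P}_{n,\mathcal L}$ does not require the nSSP but allows the nSSP. (c) If $\mathcal L\subseteq\{2i: i\in[\frac{n-1}{2}]\}$, then $\overrightarrow{P}_{n,\mathcal L}$ does not allow the nSSP.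
   Context: A digraph $G$ has vertex set $V(G)=[n]$ and arc set $E(G)\subseteq [n]\times[n]$; arcs $(v,v)$ are loops. $\mathcal M(G)$ is the set of real $n\times n$ matrices $A=(a_{ij})$ with $a_{ij}\neq 0$ if and only if $(i,j)\in E(G)$. A real $n\times n$ matrix $A$ has the nSSP if the only real matrix $X$ with $A\circ X=O$ (entrywise product) and $AX^\top-X^\top A=O$ is $X=O$. A digraph $G$ requires the nSSP if every $A\in\mathcal M(G)$ has the nSSP, and allows the nSSP if some $A\in\mathcal M(G)$ has it. For $\mathcal L\subseteq[n]$, the double path $\overrightarrow{P}_{n,\mathcal L}$ has vertex set $[n]$ and arc set $\{(i,i+1),(i+1,i): i\in[n-1]\}\cup\{(\ell,\ell):\ell\in\mathcal L\}$. *)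

theory Defs
  imports Graph_Theory.Pair_Digraph Jordan_Normal_Form.Matrix
begin

(* JNF matrices are indexed from 0, vertices from 1: the entry a_(ij) is A $$ (i - 1, j - 1). *)

(* Meant for digraphs with vertex set {1..n} for some n. *)
definition matrices_of :: "nat pair_pre_digraph \<Rightarrow> real mat set" where
  "matrices_of G = {A \<in> carrier_mat (card (pverts G)) (card (pverts G)).
     \<forall>i \<in> pverts G. \<forall>j \<in> pverts G. A $$ (i - 1, j - 1) \<noteq> 0 \<longleftrightarrow> (i, j) \<in> parcs G}"

definition hadamard_mat :: "'a :: times mat \<Rightarrow> 'a mat \<Rightarrow> 'a mat" where
  "hadamard_mat A B = mat (dim_row A) (dim_col A) (\<lambda>(i, j). A $$ (i, j) * B $$ (i, j))"

definition has_nSSP :: "real mat \<Rightarrow> bool" where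
  "has_nSSP A \<longleftrightarrow> square_mat A \<and>
     (let n = dim_row A in
      \<forall>X \<in> carrier_mat n n.
        hadamard_mat A X = 0\<^sub>m n n \<and>
        A * transpose_mat X - transpose_mat X * A = 0\<^sub>m n n \<longrightarrow> X = 0\<^sub>m n n)"

definition requires_nSSP :: "nat pair_pre_digraph \<Rightarrow> bool" where
  "requires_nSSP G \<longleftrightarrow> (\<forall>A \<in> matrices_of G. has_nSSP A)"

definition allows_nSSP :: "nat pair_pre_digraph \<Rightarrow> bool" where
  "allows_nSSP G \<longleftrightarrow> (\<exists>A \<in> matrices_of G. has_nSSP A)"

definition double_path :: "nat \<Rightarrow> nat set \<Rightarrow> nat pair_pre_digraph" where
  "double_path n L = \<lparr> pverts = {1..n},
     parcs = (\<Union>i \<in> {1..n - 1}. {(i, i + 1), (i + 1, i)}) \<union> {(l, l) | l. l \<in> L} \<rparr>"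

lemma pair_fin_digraph_double_path:
  assumes "L \<subseteq> {1..n}"
  shows "pair_fin_digraph (double_path n L)"
proof
  fix e assume "e \<in> parcs (double_path n L)"
  then show "fst e \<in> pverts (double_path n L)" "snd e \<in> pverts (double_path n L)"
    using assms unfolding double_path_def by force+
next
  have "{(l, l) | l. l \<in> L} = (\<lambda>l. (l, l)) ` L" by auto
  then show "finite (parcs (double_path n L))"
    using finite_subset[OF assms] by (simp add: double_path_def)
qed (simp add: double_path_def)

end

theory Submission
  imports Defs
begin

text \<open>A matrix \<open>A\<close> of a double path is tridiagonal with nonzero off-diagonal entries, so it lacks the nSSP
  iff some nonzero \<open>Y\<close> commutes with \<open>A\<close> and vanishes next to the diagonal and at the loops.
  Such a \<open>Y\<close> is determined by its first row, and, diagonal by diagonal, by its main diagonal.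
  If \<open>J\<close> denotes the reversal matrix and \<open>A\<close> is centrosymmetric, then \<open>J\<close>, \<open>I - J\<close> or \<open>A J\<close> is
  an obstruction in most of the negative cases; for the loops \<open>{2..n - 1}\<close> one takes \<open>A\<close> with
  constant row sums and perturbs the all-ones matrix. In (C)(c), the product of a right and a left null vector,
  both supported on the odd vertices, obstructs every matrix. In (B), the odd diagonals and the
  second row vanish, after which the first row is a left null vector of a nonsingular matrix. The two
  positive existence results use explicit matrices with broken reflection symmetry.\<close>

section \<open>The nSSP of double paths in terms of commuting with a tridiagonal matrix\<close>

text \<open>Commutation of \<open>Y\<close> with the tridiagonal matrix whose entries at (i, i), (i,
  i+1) and (i+1, i) are \<open>a i\<close>, \<open>b i\<close> and \<open>c i\<close>. Padding
  \<open>Y\<close> by zeros lets one equation cover the border rows and columns too: there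
  \<open>b\<close> and \<open>c\<close> at 0 and \<open>n\<close> only multiply zeros.\<close>

definition tri_centralizes ::
  "nat \<Rightarrow> (nat \<Rightarrow> real) \<Rightarrow> (nat \<Rightarrow> real) \<Rightarrow> (nat \<Rightarrow> real) \<Rightarrow> (nat \<Rightarrow> nat \<Rightarrow> real) \<Rightarrow> bool" where
  "tri_centralizes n a b c Y \<longleftrightarrow>
     (\<forall>i j. i \<notin> {1..n} \<or> j \<notin> {1..n} \<longrightarrow> Y i j = 0) \<and>
     (\<forall>i \<in> {1..n}. \<forall>j \<in> {1..n}.
        c (i - 1) * Y (i - 1) j + a i * Y i j + b i * Y (i + 1) j =
        b (j - 1) * Y i (j - 1) + a j * Y i j + c j * Y i (j + 1))"

definition path_free :: "nat set \<Rightarrow> (nat \<Rightarrow> nat \<Rightarrow> real) \<Rightarrow> bool" where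
  "path_free L Y \<longleftrightarrow> (\<forall>i. Y i (i + 1) = 0 \<and> Y (i + 1) i = 0) \<and> (\<forall>i \<in> L. Y i i = 0)"

lemma sum_tridiagonal:
  fixes f g :: "nat \<Rightarrow> real"
  assumes i: "i \<in> {1..n}" and f: "\<And>k. k \<in> {1..n} \<Longrightarrow> k \<notin> {i - 1, i, i + 1} \<Longrightarrow> f k = 0"
    and g: "g 0 = 0" "g (n + 1) = 0"
  shows "(\<Sum>k<n. f (Suc k) * g (Suc k)) = f (i - 1) * g (i - 1) + f i * g i + f (i + 1) * g (i + 1)"
proof -
  have "(\<Sum>k<n. f (Suc k) * g (Suc k)) = (\<Sum>k\<in>{1..n}. f k * g k)"
    by (simp add: sum.atLeast1_atMost_eq)
  \<comment> \<open>The two added terms are zero, and now i - 1 and i + 1 lie in the range even for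
    i = 1 and i = n.\<close>
  also have "\<dots> = (\<Sum>k\<in>{0..n+1}. f k * g k)"
    by (rule sum.mono_neutral_left) (use g in \<open>auto simp: not_less_eq_eq le_Suc_eq\<close>)
  also have "\<dots> = (\<Sum>k\<in>{i - 1, i, i + 1}. f k * g k)"
  proof (rule sum.mono_neutral_right)
    show "\<forall>k\<in>{0..n + 1} - {i - 1, i, i + 1}. f k * g k = 0"
    proof
      fix k assume k: "k \<in> {0..n + 1} - {i - 1, i, i + 1}"
      show "f k * g k = 0"
      proof (cases "k = 0 \<or> k = n + 1")
        case True then show ?thesis using g by auto
      next
        case False
        then have "k \<in> {1..n}" using k by auto
        then show ?thesis using f k by simp
      qed
    qed
  qed (use i in auto)
  also have "\<dots> = f (i - 1) * g (i - 1) + f i * g i + f (i + 1) * g (i + 1)"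
    using i by (cases i) auto
  finally show ?thesis .
qed

lemma parcs_double_path:
  assumes "i \<in> {1..n}" "j \<in> {1..n}"
  shows "(i, j) \<in> parcs (double_path n L) \<longleftrightarrow> j = i + 1 \<or> i = j + 1 \<or> i = j \<and> i \<in> L"
  using assms unfolding double_path_def by auto

lemma matrices_of_double_path:
  "A \<in> matrices_of (double_path n L) \<longleftrightarrow> A \<in> carrier_mat n n \<and>
     (\<forall>i \<in> {1..n}. \<forall>j \<in> {1..n}. A $$ (i - 1, j - 1) \<noteq> 0 \<longleftrightarrow> j = i + 1 \<or> i = j + 1 \<or> i = j \<and> i \<in> L)"
proof -
  have "pverts (double_path n L) = {1..n}" by (simp add: double_path_def)
  then show ?thesis unfolding matrices_of_def using parcs_double_path by auto
qed

text \<open>At the border the indices of \<open>A\<close> degenerate: for \<open>i = 1\<close> the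
  entry \<open>A $$ (i - 1, i - 2)\<close> is a diagonal one by truncated subtraction, and for
  \<open>i = n\<close> the column index \<open>i\<close> is out of bounds. Both are multiplied by
  padding zeros of \<open>Y\<close>; likewise for \<open>j\<close>.\<close>

lemma tridiagonal_mult:
  fixes A :: "real mat" and Y :: "nat \<Rightarrow> nat \<Rightarrow> real"
  assumes A: "A \<in> matrices_of (double_path n L)"
    and Y: "\<And>i j. i \<notin> {1..n} \<or> j \<notin> {1..n} \<Longrightarrow> Y i j = 0"
    and i: "i \<in> {1..n}" and j: "j \<in> {1..n}"
  defines "M \<equiv> mat n n (\<lambda>(i, j). Y (i + 1) (j + 1))"
  shows "(A * M) $$ (i - 1, j - 1) =
      A $$ (i - 1, i - 2) * Y (i - 1) j + A $$ (i - 1, i - 1) * Y i j + A $$ (i - 1, i) * Y (i + 1) j"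
    and "(M * A) $$ (i - 1, j - 1) =
      A $$ (j - 2, j - 1) * Y i (j - 1) + A $$ (j - 1, j - 1) * Y i j + A $$ (j, j - 1) * Y i (j + 1)"
proof -
  have car: "A \<in> carrier_mat n n"
    using A unfolding matrices_of_double_path by auto
  have zero: "A $$ (i - 1, j - 1) = 0"
    if "i \<in> {1..n}" "j \<in> {1..n}" "j \<noteq> i" "j \<noteq> i + 1" "i \<noteq> j + 1" for i j
    using A that unfolding matrices_of_double_path by blast
  have dims: "dim_row A = n" "dim_col A = n" using car by auto
  have ij: "i - 1 < n" "j - 1 < n" "Suc (i - 1) = i" "Suc (j - 1) = j" using i j by auto
  have "(A * M) $$ (i - 1, j - 1) = (\<Sum>k<n. A $$ (i - 1, Suc k - 1) * Y (Suc k) j)"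
    using ij dims by (simp add: M_def scalar_prod_def lessThan_atLeast0)
  also have "\<dots> = A $$ (i - 1, i - 1 - 1) * Y (i - 1) j + A $$ (i - 1, i - 1) * Y i j
      + A $$ (i - 1, i + 1 - 1) * Y (i + 1) j"
  proof (rule sum_tridiagonal[OF i])
    fix k assume "k \<in> {1..n}" "k \<notin> {i - 1, i, i + 1}"
    then show "A $$ (i - 1, k - 1) = 0" by (intro zero) (use i in auto)
  qed (use Y in auto)
  finally show "(A * M) $$ (i - 1, j - 1) =
      A $$ (i - 1, i - 2) * Y (i - 1) j + A $$ (i - 1, i - 1) * Y i j + A $$ (i - 1, i) * Y (i + 1) j"
    by (simp add: numeral_2_eq_2)
  have "(M * A) $$ (i - 1, j - 1) = (\<Sum>k<n. A $$ (Suc k - 1, j - 1) * Y i (Suc k))"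
    using ij dims by (simp add: M_def scalar_prod_def lessThan_atLeast0 mult.commute)
  also have "\<dots> = A $$ (j - 1 - 1, j - 1) * Y i (j - 1) + A $$ (j - 1, j - 1) * Y i j
      + A $$ (j + 1 - 1, j - 1) * Y i (j + 1)"
  proof (rule sum_tridiagonal[OF j])
    fix k assume "k \<in> {1..n}" "k \<notin> {j - 1, j, j + 1}"
    then show "A $$ (k - 1, j - 1) = 0" by (intro zero) (use j in auto)
  qed (use Y in auto)
  finally show "(M * A) $$ (i - 1, j - 1) =
      A $$ (j - 2, j - 1) * Y i (j - 1) + A $$ (j - 1, j - 1) * Y i j + A $$ (j, j - 1) * Y i (j + 1)"
    by (simp add: numeral_2_eq_2)
qed

lemma mat_eq_shift_iff:
  assumes "B \<in> carrier_mat n n" "C \<in> carrier_mat n n"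
  shows "B = C \<longleftrightarrow> (\<forall>i \<in> {1..n}. \<forall>j \<in> {1..n}. B $$ (i - 1, j - 1) = C $$ (i - 1, j - 1))"
    (is "_ \<longleftrightarrow> ?r")
proof
  assume r: ?r
  show "B = C"
  proof (rule eq_matI)
    fix i j assume "i < dim_row C" "j < dim_col C"
    then show "B $$ (i, j) = C $$ (i, j)"
      using r[rule_format, of "i + 1" "j + 1"] assms(2) by auto
  qed (use assms in auto)
qed simp

text \<open>The function \<open>Y\<close> stands for the transpose of the matrix \<open>X\<close> in the definition of the nSSP,
  indexed from 1 and padded by zeros. The arc pattern being symmetric, \<open>A \<circ> X = O\<close> says that
  \<open>Y\<close> vanishes on the arcs.\<close>

lemma has_nSSP_double_path_iff:
  fixes A :: "real mat"
  assumes A: "A \<in> matrices_of (double_path n L)" and L: "L \<subseteq> {1..n}"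
  shows "has_nSSP A \<longleftrightarrow>
    (\<forall>Y. tri_centralizes n (\<lambda>i. A $$ (i - 1, i - 1)) (\<lambda>i. A $$ (i - 1, i)) (\<lambda>i. A $$ (i, i - 1)) Y \<and>
       path_free L Y \<longrightarrow> (\<forall>i j. Y i j = 0))"
    (is "_ \<longleftrightarrow> (\<forall>Y. tri_centralizes n ?a ?b ?c Y \<and> _ \<longrightarrow> _)")
proof -
  have car: "A \<in> carrier_mat n n"
    and pat: "\<And>i j. i \<in> {1..n} \<Longrightarrow> j \<in> {1..n} \<Longrightarrow>
        A $$ (i - 1, j - 1) \<noteq> 0 \<longleftrightarrow> j = i + 1 \<or> i = j + 1 \<or> i = j \<and> i \<in> L"
    using A unfolding matrices_of_double_path by auto
  have dims: "dim_row A = n" "dim_col A = n" using car by auto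
  have nssp: "has_nSSP A \<longleftrightarrow> (\<forall>X \<in> carrier_mat n n. hadamard_mat A X = 0\<^sub>m n n \<and>
      A * transpose_mat X - transpose_mat X * A = 0\<^sub>m n n \<longrightarrow> X = 0\<^sub>m n n)"
    using car by (simp add: has_nSSP_def Let_def)
  \<comment> \<open>This dictionary serves both directions below: \<open>Y\<close> is read off from
    a given \<open>X\<close>, and every padded \<open>Y\<close> arises from some
    \<open>X\<close>.\<close>
  have key: "(hadamard_mat A X = 0\<^sub>m n n \<and> A * transpose_mat X - transpose_mat X * A = 0\<^sub>m n n) \<longleftrightarrow>
        (tri_centralizes n ?a ?b ?c Y \<and> path_free L Y)"
    if X: "X \<in> carrier_mat n n" and Y: "Y = (\<lambda>i j. if i \<in> {1..n} \<and> j \<in> {1..n} then X $$ (j - 1, i - 1) else 0)"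
    for X Y
  proof -
    have supp: "\<And>i j. i \<notin> {1..n} \<or> j \<notin> {1..n} \<Longrightarrow> Y i j = 0" unfolding Y by auto
    have YX: "\<And>i j. i \<in> {1..n} \<Longrightarrow> j \<in> {1..n} \<Longrightarrow> Y i j = X $$ (j - 1, i - 1)" unfolding Y by auto
    have T: "transpose_mat X = mat n n (\<lambda>(i, j). Y (i + 1) (j + 1))"
      using X by (intro eq_matI) (auto simp: Y)
    define M where "M = A * transpose_mat X"
    define N where "N = transpose_mat X * A"
    have MN: "M \<in> carrier_mat n n" "N \<in> carrier_mat n n"
      using X car unfolding M_def N_def by auto
    then have "(M - N) $$ (i - 1, j - 1) = M $$ (i - 1, j - 1) - N $$ (i - 1, j - 1)"
      "0\<^sub>m n n $$ (i - 1, j - 1) = (0 :: real)" if "i \<in> {1..n}" "j \<in> {1..n}" for i j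
      using that by (auto intro!: index_minus_mat)
    then have "M - N = 0\<^sub>m n n \<longleftrightarrow> (\<forall>i \<in> {1..n}. \<forall>j \<in> {1..n}. M $$ (i - 1, j - 1) = N $$ (i - 1, j - 1))"
      using mat_eq_shift_iff[OF minus_carrier_mat[OF MN(2)] zero_carrier_mat] by simp
    also have "\<dots> \<longleftrightarrow> (\<forall>i \<in> {1..n}. \<forall>j \<in> {1..n}.
        ?c (i - 1) * Y (i - 1) j + ?a i * Y i j + ?b i * Y (i + 1) j =
        ?b (j - 1) * Y i (j - 1) + ?a j * Y i j + ?c j * Y i (j + 1))"
    proof (intro ball_cong refl)
      fix i j assume "i \<in> {1..n}" "j \<in> {1..n}"
      from tridiagonal_mult[OF A, where Y = Y, OF supp this, folded T M_def N_def]
      show "M $$ (i - 1, j - 1) = N $$ (i - 1, j - 1) \<longleftrightarrow>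
        ?c (i - 1) * Y (i - 1) j + ?a i * Y i j + ?b i * Y (i + 1) j =
        ?b (j - 1) * Y i (j - 1) + ?a j * Y i j + ?c j * Y i (j + 1)"
        by (simp add: numeral_2_eq_2)
    qed
    also have "\<dots> \<longleftrightarrow> tri_centralizes n ?a ?b ?c Y"
      using supp unfolding tri_centralizes_def by blast
    finally have 1: "M - N = 0\<^sub>m n n \<longleftrightarrow> tri_centralizes n ?a ?b ?c Y" .
    have "hadamard_mat A X = 0\<^sub>m n n \<longleftrightarrow>
        (\<forall>i \<in> {1..n}. \<forall>j \<in> {1..n}. A $$ (i - 1, j - 1) * X $$ (i - 1, j - 1) = 0)"
    proof (subst mat_eq_shift_iff[of _ n])
      show "hadamard_mat A X \<in> carrier_mat n n" using dims by (simp add: hadamard_mat_def)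
      have "hadamard_mat A X $$ (i - 1, j - 1) = A $$ (i - 1, j - 1) * X $$ (i - 1, j - 1)"
        "0\<^sub>m n n $$ (i - 1, j - 1) = (0 :: real)" if "i \<in> {1..n}" "j \<in> {1..n}" for i j
        using that dims by (auto simp: hadamard_mat_def)
      then show "(\<forall>i \<in> {1..n}. \<forall>j \<in> {1..n}. hadamard_mat A X $$ (i - 1, j - 1) = 0\<^sub>m n n $$ (i - 1, j - 1))
        \<longleftrightarrow> (\<forall>i \<in> {1..n}. \<forall>j \<in> {1..n}. A $$ (i - 1, j - 1) * X $$ (i - 1, j - 1) = 0)"
        by (intro ball_cong refl) (simp only:)
    qed simp
    also have "\<dots> \<longleftrightarrow> (\<forall>i \<in> {1..n}. \<forall>j \<in> {1..n}. (j = i + 1 \<or> i = j + 1 \<or> i = j \<and> i \<in> L) \<longrightarrow> Y j i = 0)"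
    proof (intro ball_cong refl)
      fix i j assume ij: "i \<in> {1..n}" "j \<in> {1..n}"
      show "A $$ (i - 1, j - 1) * X $$ (i - 1, j - 1) = 0 \<longleftrightarrow>
          ((j = i + 1 \<or> i = j + 1 \<or> i = j \<and> i \<in> L) \<longrightarrow> Y j i = 0)"
        unfolding YX[OF ij(2,1)] mult_eq_0_iff using pat[OF ij] by blast
    qed
    also have "\<dots> \<longleftrightarrow> path_free L Y"
    proof
      assume r: "path_free L Y"
      show "\<forall>i \<in> {1..n}. \<forall>j \<in> {1..n}. (j = i + 1 \<or> i = j + 1 \<or> i = j \<and> i \<in> L) \<longrightarrow> Y j i = 0"
        using r unfolding path_free_def by auto
    next
      assume l: "\<forall>i \<in> {1..n}. \<forall>j \<in> {1..n}. (j = i + 1 \<or> i = j + 1 \<or> i = j \<and> i \<in> L) \<longrightarrow> Y j i = 0"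
      show "path_free L Y"
        unfolding path_free_def
      proof (intro conjI allI ballI)
        show "Y i i = 0" if "i \<in> L" for i using that l L by auto
        show "Y i (i + 1) = 0" for i
          using l[rule_format, of "i + 1" i] supp[of i "i + 1"] by auto
        show "Y (i + 1) i = 0" for i
          using l[rule_format, of i "i + 1"] supp[of "i + 1" i] by auto
      qed
    qed
    finally show ?thesis using 1 unfolding M_def N_def by blast
  qed
  show ?thesis
  proof
    assume N: "has_nSSP A"
    show "\<forall>Y. tri_centralizes n ?a ?b ?c Y \<and> path_free L Y \<longrightarrow> (\<forall>i j. Y i j = 0)"
    proof (intro allI impI)
      fix Y i j assume Y: "tri_centralizes n ?a ?b ?c Y \<and> path_free L Y"
      then have supp: "\<And>i j. i \<notin> {1..n} \<or> j \<notin> {1..n} \<Longrightarrow> Y i j = 0" unfolding tri_centralizes_def by blast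
      define X where "X = mat n n (\<lambda>(j, i). Y (i + 1) (j + 1))"
      have "Y = (\<lambda>i j. if i \<in> {1..n} \<and> j \<in> {1..n} then X $$ (j - 1, i - 1) else 0)"
        unfolding X_def using supp by (intro ext) auto
      moreover have Xc: "X \<in> carrier_mat n n" by (simp add: X_def)
      ultimately have "hadamard_mat A X = 0\<^sub>m n n \<and>
          A * transpose_mat X - transpose_mat X * A = 0\<^sub>m n n"
        using key[THEN iffD2] Y by simp
      then have X0: "X = 0\<^sub>m n n" using N[unfolded nssp] Xc by simp
      show "Y i j = 0"
      proof (cases "i \<in> {1..n} \<and> j \<in> {1..n}")
        case True
        then have "X $$ (j - 1, i - 1) = Y i j" by (auto simp: X_def)
        moreover have "X $$ (j - 1, i - 1) = 0" using True X0 by auto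
        ultimately show ?thesis by simp
      qed (use supp in blast)
    qed
  next
    assume R: "\<forall>Y. tri_centralizes n ?a ?b ?c Y \<and> path_free L Y \<longrightarrow> (\<forall>i j. Y i j = 0)"
    show "has_nSSP A" unfolding nssp
    proof (intro ballI impI)
      fix X :: "real mat" assume X: "X \<in> carrier_mat n n"
        and h: "hadamard_mat A X = 0\<^sub>m n n \<and> A * transpose_mat X - transpose_mat X * A = 0\<^sub>m n n"
      define Y where "Y = (\<lambda>i j. if i \<in> {1..n} \<and> j \<in> {1..n} then X $$ (j - 1, i - 1) else 0)"
      have z: "\<forall>i j. Y i j = 0" using R[rule_format, OF key[OF X Y_def, THEN iffD1, OF h]] by simp
      show "X = 0\<^sub>m n n"
        unfolding mat_eq_shift_iff[OF X zero_carrier_mat]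
      proof (intro ballI)
        fix i j assume "i \<in> {1..n}" "j \<in> {1..n}"
        then show "X $$ (i - 1, j - 1) = 0\<^sub>m n n $$ (i - 1, j - 1)"
          using z[rule_format, of j i] by (auto simp: Y_def)
      qed
    qed
  qed
qed

section \<open>Explicit matrices and criteria for requiring and allowing the nSSP\<close>

text \<open>The 0-based position (i, i-1) of \<open>c i\<close> is the 1-based position (i+1, i), in
  accordance with \<open>tri_centralizes\<close>.\<close>

definition tri_mat :: "nat \<Rightarrow> (nat \<Rightarrow> real) \<Rightarrow> (nat \<Rightarrow> real) \<Rightarrow> real mat" where
  "tri_mat n a c = mat n n (\<lambda>(i, j). if i = j then a (i + 1) else if j = i + 1 then 1
     else if i = j + 1 then c i else 0)"

lemma tri_mat_in_matrices_of:
  assumes "\<And>i. i \<in> {1..n} \<Longrightarrow> a i \<noteq> 0 \<longleftrightarrow> i \<in> L" "\<And>i. c i \<noteq> 0"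
  shows "tri_mat n a c \<in> matrices_of (double_path n L)"
  unfolding matrices_of_double_path
proof (intro conjI ballI)
  fix i j assume ij: "i \<in> {1..n}" "j \<in> {1..n}"
  then obtain i' j' where "i = Suc i'" "j = Suc j'" by (auto simp: not_less_eq_eq gr0_conv_Suc Suc_le_eq)
  then show "tri_mat n a c $$ (i - 1, j - 1) \<noteq> 0 \<longleftrightarrow> j = i + 1 \<or> i = j + 1 \<or> i = j \<and> i \<in> L"
    using ij assms(1)[of i] assms(2)[of i'] by (auto simp: tri_mat_def)
qed (simp add: tri_mat_def)

text \<open>Outside \<open>{1..<n}\<close> the off-diagonal coefficients meet only padding zeros.
  This matters because matrix entries read off there are misplaced or out of bounds.\<close>

lemma tri_centralizes_cong:
  assumes "\<And>i. i \<in> {1..n} \<Longrightarrow> a i = a' i"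
    and "\<And>i. i \<in> {1..<n} \<Longrightarrow> b i = b' i" "\<And>i. i \<in> {1..<n} \<Longrightarrow> c i = c' i"
  shows "tri_centralizes n a b c Y \<longleftrightarrow> tri_centralizes n a' b' c' Y"
proof (cases "\<forall>i j. i \<notin> {1..n} \<or> j \<notin> {1..n} \<longrightarrow> Y i j = 0")
  case True
  have "c (i - 1) * Y (i - 1) j = c' (i - 1) * Y (i - 1) j" "b (j - 1) * Y i (j - 1) = b' (j - 1) * Y i (j - 1)"
    "c j * Y i (j + 1) = c' j * Y i (j + 1)" "b i * Y (i + 1) j = b' i * Y (i + 1) j"
    if "i \<in> {1..n}" "j \<in> {1..n}" for i j
  proof -
    show "c (i - 1) * Y (i - 1) j = c' (i - 1) * Y (i - 1) j"
    proof (cases "i = 1")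
      case False
      then have "i - 1 \<in> {1..<n}" using that by auto
      then show ?thesis using assms(3) by simp
    qed (use True in simp)
    show "b (j - 1) * Y i (j - 1) = b' (j - 1) * Y i (j - 1)"
    proof (cases "j = 1")
      case False
      then have "j - 1 \<in> {1..<n}" using that by auto
      then show ?thesis using assms(2) by simp
    qed (use True in simp)
    show "c j * Y i (j + 1) = c' j * Y i (j + 1)"
      using that True assms(3) by (cases "j = n") auto
    show "b i * Y (i + 1) j = b' i * Y (i + 1) j"
      using that True assms(2) by (cases "i = n") auto
  qed
  then show ?thesis
    unfolding tri_centralizes_def by (intro conj_cong ball_cong refl) (simp only: assms(1))
next
  case False
  then show ?thesis unfolding tri_centralizes_def by blast
qed

lemma has_nSSP_tri_mat_iff:
  assumes "\<And>i. i \<in> {1..n} \<Longrightarrow> a i \<noteq> 0 \<longleftrightarrow> i \<in> L" "\<And>i. c i \<noteq> 0" "L \<subseteq> {1..n}"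
  shows "has_nSSP (tri_mat n a c) \<longleftrightarrow>
    (\<forall>Y. tri_centralizes n a (\<lambda>_. 1) c Y \<and> path_free L Y \<longrightarrow> (\<forall>i j. Y i j = 0))"
proof -
  have "tri_centralizes n (\<lambda>i. tri_mat n a c $$ (i - 1, i - 1)) (\<lambda>i. tri_mat n a c $$ (i - 1, i))
          (\<lambda>i. tri_mat n a c $$ (i, i - 1)) Y \<longleftrightarrow> tri_centralizes n a (\<lambda>_. 1) c Y" for Y
    by (rule tri_centralizes_cong) (auto simp: tri_mat_def)
  then show ?thesis
    by (simp only: has_nSSP_double_path_iff[OF tri_mat_in_matrices_of[OF assms(1,2)] assms(3)])
qed

lemma not_requires_nSSPI:
  assumes "\<And>i. i \<in> {1..n} \<Longrightarrow> a i \<noteq> 0 \<longleftrightarrow> i \<in> L" "L \<subseteq> {1..n}"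
    and "tri_centralizes n a (\<lambda>_. 1) (\<lambda>_. 1) Y" "path_free L Y" "Y i j \<noteq> 0"
  shows "\<not> requires_nSSP (double_path n L)"
proof -
  have "has_nSSP (tri_mat n a (\<lambda>_. 1)) \<longleftrightarrow>
      (\<forall>Y. tri_centralizes n a (\<lambda>_. 1) (\<lambda>_. 1) Y \<and> path_free L Y \<longrightarrow> (\<forall>i j. Y i j = 0))"
    by (rule has_nSSP_tri_mat_iff) (use assms(1,2) in auto)
  then have "\<not> has_nSSP (tri_mat n a (\<lambda>_. 1))"
    using assms(3-5) by blast
  moreover have "tri_mat n a (\<lambda>_. 1) \<in> matrices_of (double_path n L)"
    by (rule tri_mat_in_matrices_of) (use assms(1) in auto)
  ultimately show ?thesis unfolding requires_nSSP_def by blast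
qed

text \<open>Unlike in \<open>not_requires_nSSPI\<close>, the subdiagonal stays free:
  \<open>allows_nSSP_complement_of_centre\<close> needs a nonconstant one.\<close>

lemma allows_nSSPI:
  assumes "\<And>i. i \<in> {1..n} \<Longrightarrow> a i \<noteq> 0 \<longleftrightarrow> i \<in> L" "\<And>i. c i \<noteq> 0" "L \<subseteq> {1..n}"
    and "\<And>Y i j. tri_centralizes n a (\<lambda>_. 1) c Y \<Longrightarrow> path_free L Y \<Longrightarrow> Y i j = 0"
  shows "allows_nSSP (double_path n L)"
proof -
  have "has_nSSP (tri_mat n a c) \<longleftrightarrow>
      (\<forall>Y. tri_centralizes n a (\<lambda>_. 1) c Y \<and> path_free L Y \<longrightarrow> (\<forall>i j. Y i j = 0))"
    by (rule has_nSSP_tri_mat_iff[OF assms(1-3)])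
  then have "has_nSSP (tri_mat n a c)" using assms(4) by blast
  moreover have "tri_mat n a c \<in> matrices_of (double_path n L)"
    by (rule tri_mat_in_matrices_of[OF assms(1,2)])
  ultimately show ?thesis unfolding allows_nSSP_def by blast
qed

section \<open>Entries that determine a commuting matrix\<close>

text \<open>Since \<open>b i\<close> is nonzero, row \<open>i\<close> of the commutation equation
  expresses row \<open>i + 1\<close> of \<open>Y\<close> through the two preceding rows. The
  induction starts from the padding row 0 and row 1.\<close>

lemma first_row_zero_imp_zero:
  assumes Y: "tri_centralizes n a b c Y" and b: "\<And>i. i \<in> {1..<n} \<Longrightarrow> b i \<noteq> 0"
    and row: "\<And>j. Y 1 j = 0"
  shows "Y i j = 0"
proof -
  have supp: "\<And>i j. i \<notin> {1..n} \<or> j \<notin> {1..n} \<Longrightarrow> Y i j = 0"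
    and comm: "\<And>i j. i \<in> {1..n} \<Longrightarrow> j \<in> {1..n} \<Longrightarrow>
        c (i - 1) * Y (i - 1) j + a i * Y i j + b i * Y (i + 1) j =
        b (j - 1) * Y i (j - 1) + a j * Y i j + c j * Y i (j + 1)"
    using Y unfolding tri_centralizes_def by blast+
  have "\<forall>j. Y i j = 0 \<and> Y (i + 1) j = 0"
  proof (induction i)
    case 0
    then show ?case using supp row by auto
  next
    case (Suc i)
    have "Y (i + 2) j = 0" for j
    proof (cases "i + 2 \<in> {1..n} \<and> j \<in> {1..n}")
      case True
      then show ?thesis using comm[of "i + 1" j] Suc b[of "i + 1"] by simp
    qed (use supp in blast)
    then show ?case using Suc by simp
  qed
  then show ?thesis by blast
qed

text \<open>The equation at (i+1, i+k+2) involves only the superdiagonals k, k+1 and k+2. Once the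
  first two vanish, it is a two-term recursion along the third, which starts at a padding zero in
  row 0. This clears the upper triangle, in particular the first row, and
  \<open>first_row_zero_imp_zero\<close> does the rest.\<close>

lemma diag_zero_imp_zero:
  assumes Y: "tri_centralizes n a b c Y" and b: "\<And>i. i \<in> {1..<n} \<Longrightarrow> b i \<noteq> 0"
    and c: "\<And>i. i \<in> {1..<n} \<Longrightarrow> c i \<noteq> 0" and free: "path_free L Y"
    and diag: "\<And>i. Y i i = 0"
  shows "Y i j = 0"
proof -
  have supp: "\<And>i j. i \<notin> {1..n} \<or> j \<notin> {1..n} \<Longrightarrow> Y i j = 0"
    and comm: "\<And>i j. i \<in> {1..n} \<Longrightarrow> j \<in> {1..n} \<Longrightarrow>
        c (i - 1) * Y (i - 1) j + a i * Y i j + b i * Y (i + 1) j =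
        b (j - 1) * Y i (j - 1) + a j * Y i j + c j * Y i (j + 1)"
    using Y unfolding tri_centralizes_def by blast+
  have "\<forall>i. Y i (i + k) = 0 \<and> Y i (i + k + 1) = 0" for k
  proof (induction k)
    case 0
    then show ?case using diag free unfolding path_free_def by auto
  next
    case (Suc k)
    have "Y i (i + k + 2) = 0" for i
    proof (induction i)
      case 0
      then show ?case using supp by simp
    next
      case (Suc i)
      show ?case
      proof (cases "i + k + 2 < n")
        case True
        have "Y (i + 2) (i + k + 2) = 0" "Y (i + 1) (i + k + 1) = 0" "Y (i + 1) (i + k + 2) = 0"
          using Suc.IH \<open>\<forall>i. Y i (i + k) = 0 \<and> Y i (i + k + 1) = 0\<close>[rule_format, of "i + 2"]
            \<open>\<forall>i. Y i (i + k) = 0 \<and> Y i (i + k + 1) = 0\<close>[rule_format, of "i + 1"] by (simp_all add: algebra_simps)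
        then show ?thesis
          using comm[of "i + 1" "i + k + 2"] Suc.IH True c[of "i + k + 2"] by (simp add: algebra_simps)
      qed (use supp in auto)
    qed
    then show ?case using Suc by simp
  qed
  then have "Y 1 (1 + k) = 0" for k by blast
  then have "Y 1 j = 0" for j by (cases j) (use supp in auto)
  then show ?thesis using first_row_zero_imp_zero[OF Y b] by blast
qed

section \<open>A single loop at vertex 2, for even n\<close>

lemma requires_nSSP_double_path_2:
  assumes "even n" "n > 0"
  shows "requires_nSSP (double_path n {2})"
  unfolding requires_nSSP_def
proof
  fix A assume A: "A \<in> matrices_of (double_path n {2})"
  have n2: "n \<ge> 2" using assms by presburger
  have pat: "\<And>i j. i \<in> {1..n} \<Longrightarrow> j \<in> {1..n} \<Longrightarrow>
      A $$ (i - 1, j - 1) \<noteq> 0 \<longleftrightarrow> j = i + 1 \<or> i = j + 1 \<or> i = j \<and> i \<in> {2}"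
    using A unfolding matrices_of_double_path by blast
  define a b c where "a = (\<lambda>i. A $$ (i - 1, i - 1))" "b = (\<lambda>i. A $$ (i - 1, i))" "c = (\<lambda>i. A $$ (i, i - 1))"
  have a: "a i = 0" if "i \<in> {1..n}" "i \<noteq> 2" for i
    using pat[OF that(1,1)] that(2) unfolding a_b_c_def by auto
  have a2: "a 2 \<noteq> 0" using pat[of 2 2] n2 unfolding a_b_c_def by auto
  have b: "b i \<noteq> 0" and c: "c i \<noteq> 0" if "i \<in> {1..<n}" for i
    using pat[of i "i + 1"] pat[of "i + 1" i] that unfolding a_b_c_def by auto
  have "Y i j = 0" if Y: "tri_centralizes n a b c Y" and free: "path_free {2} Y" for Y i j
  proof -
    have supp: "\<And>i j. i \<notin> {1..n} \<or> j \<notin> {1..n} \<Longrightarrow> Y i j = 0"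
      and comm: "\<And>i j. i \<in> {1..n} \<Longrightarrow> j \<in> {1..n} \<Longrightarrow>
        c (i - 1) * Y (i - 1) j + a i * Y i j + b i * Y (i + 1) j =
        b (j - 1) * Y i (j - 1) + a j * Y i j + c j * Y i (j + 1)"
      using Y unfolding tri_centralizes_def by blast+
    have off: "\<And>i. Y i (i + 1) = 0" "\<And>i. Y (i + 1) i = 0" "Y 2 2 = 0"
      using free unfolding path_free_def by auto
    have odd_diag: "\<forall>i. Y i (i + 2 * r + 1) = 0" for r
    proof (induction r)
      case 0
      then show ?case using off by simp
    next
      case (Suc r)
      have IH: "Y i j = 0" if "j = i + 2 * r + 1" for i j using Suc that by blast
      \<comment> \<open>The diagonal is cleared from both ends: its entry in row 1 by a border
        equation, those in rows i \<ge> 2 downwards from the padding beyond column n. This avoids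
        equations in row 2, whose loop term would bring in an even diagonal.\<close>
      have one: "Y 1 (1 + 2 * r + 3) = 0"
      proof (cases "2 * r + 4 \<le> n")
        case True
        have "Y (Suc (Suc 0)) (2 * r + 3) = 0" "Y 1 (2 * r + 2) = 0" by (intro IH; simp)+
        then show ?thesis
          using comm[of 1 "2 * r + 3"] True a[of 1] a[of "2 * r + 3"] c[of "2 * r + 3"] supp[of 0]
          by (simp add: algebra_simps)
      qed (use supp in auto)
      have step: "Y i (i + 2 * r + 3) = 0" if i: "i \<ge> 2" "Y (i + 1) (i + 1 + 2 * r + 3) = 0" for i
      proof (cases "i + 2 * r + 3 \<le> n")
        case True
        have "Y (i + 2) (i + 2 * r + 3) = 0" "Y (i + 1) (i + 2 * r + 2) = 0"
          by (intro IH; simp)+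
        then show ?thesis
          using comm[of "i + 1" "i + 2 * r + 3"] True a[of "i + 1"] a[of "i + 2 * r + 3"] c[of i] i
          by (simp add: algebra_simps)
      qed (use supp in auto)
      have "Y i (i + 2 * r + 3) = 0" if "i \<ge> 2" for i
      proof (cases "i \<le> n")
        case True
        then show ?thesis using that
          by (induction i rule: inc_induct) (use supp step in auto)
      qed (use supp in auto)
      moreover have "Y i (i + 2 * r + 3) = 0" if "\<not> i \<ge> 2" for i
      proof -
        have "i = 0 \<or> i = 1" using that by auto
        then show ?thesis using one supp[of 0] by auto
      qed
      ultimately have "Y i (i + 2 * r + 3) = 0" for i by blast
      moreover have "i + 2 * Suc r + 1 = i + 2 * r + 3" for i by simp
      ultimately show ?case by (simp only:) simp
    qed
    then have odd_up: "Y i j = 0" if "i < j" "odd (i + j)" for i j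
    proof -
      have "\<exists>r. j = i + 2 * r + 1" using that by presburger
      then show ?thesis using odd_diag by blast
    qed
    have even_row1: "Y 1 j = 0" if "even j" for j
      by (cases "j = 0") (use that supp in \<open>auto intro!: odd_up\<close>)
    \<comment> \<open>Here the loop acts: for even j > 2 all neighbours in the equation at (2, j)
      lie on odd diagonals, so that \<open>a 2 * Y 2 j = 0\<close> remains.\<close>
    have row2: "Y 2 j = 0" for j
    proof -
      consider "j = 0" | "j = 1" | "j = 2" | "j > 2" "odd j" | "j > 2" "even j" by linarith
      then show ?thesis
      proof cases
        case 2
        then show ?thesis using off(2)[of 1] by (simp add: numeral_2_eq_2)
      next
        case 5
        show ?thesis
        proof (cases "j \<le> n")
          case True
          have "j \<noteq> 3" using 5 by auto
          then have "Y 1 j = 0" "Y 3 j = 0" "Y 2 (j - 1) = 0" "Y 2 (j + 1) = 0"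
            using 5 by (auto intro!: odd_up)
          then show ?thesis using comm[of 2 j] a[of j] a2 True 5 by simp
        qed (use supp in auto)
      qed (use supp off(3) in \<open>auto intro!: odd_up\<close>)
    qed
    \<comment> \<open>With row 2 gone, the equation at (1, j) for even j links
      \<open>Y 1 (j - 1)\<close> to \<open>Y 1 (j + 1)\<close>. As n is even, the chain can start at
      j = n, where \<open>Y 1 (n + 1)\<close> is padding. Once the truncated index reaches 0, the
      entry is padding as well.\<close>
    have odd_row1: "Y 1 (n - (2 * k + 1)) = 0" for k
    proof (induction k)
      case 0
      then show ?case using comm[of 1 n] a[of 1] a[of n] supp[of 0] supp[of 1 "n + 1"] row2 even_row1[of n] assms n2 b[of "n - 1"]
        by (simp add: numeral_2_eq_2)
    next
      case (Suc k)
      show ?case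
      proof (cases "n > 2 * k + 2")
        case True
        define j where "j = n - (2 * k + 2)"
        have j: "even j" "j \<in> {1..<n}" "j \<ge> 2" using True assms unfolding j_def by (auto, presburger)
        have "j + 1 = n - (2 * k + 1)" using True unfolding j_def by linarith
        then have "Y 1 (j + 1) = 0" using Suc by simp
        moreover have "b (j - 1) \<noteq> 0" by (rule b) (use j in auto)
        ultimately have "Y 1 (j - 1) = 0"
          using comm[of 1 j] a[of 1] supp[of 0] row2 even_row1[of j] j
          by (simp add: numeral_2_eq_2)
        then show ?thesis by (simp add: j_def)
      qed (use supp in simp)
    qed
    have "Y 1 j = 0" for j
    proof (cases "even j \<or> j > n")
      case False
      then have "odd (n - j)" using assms by simp
      then obtain k where "n - j = 2 * k + 1" by (elim oddE)
      then have "j = n - (2 * k + 1)" using False by simp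
      then show ?thesis using odd_row1 by simp
    qed (use even_row1 supp in auto)
    then show ?thesis using first_row_zero_imp_zero[OF Y b] by blast
  qed
  then show "has_nSSP A"
    using has_nSSP_double_path_iff[OF A] n2 unfolding a_b_c_def by simp
qed

section \<open>Loops at even vertices only, for odd n\<close>

text \<open>For \<open>A v = 0\<close> and \<open>w^T A = 0\<close>, the matrix
  \<open>Y = v w^T\<close> commutes with \<open>A\<close>, both products being zero. If
  \<open>v\<close> and \<open>w\<close> live on the odd vertices, \<open>Y\<close> vanishes next to
  the diagonal and at even diagonal positions.\<close>

lemma not_allows_nSSP_even_loops:
  assumes n: "odd n" and L: "L \<subseteq> {1..n}" "\<And>l. l \<in> L \<Longrightarrow> even l"
  shows "\<not> allows_nSSP (double_path n L)"
proof
  assume "allows_nSSP (double_path n L)"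
  then obtain A where A: "A \<in> matrices_of (double_path n L)" and N: "has_nSSP A"
    unfolding allows_nSSP_def by blast
  have pat: "\<And>i j. i \<in> {1..n} \<Longrightarrow> j \<in> {1..n} \<Longrightarrow>
      A $$ (i - 1, j - 1) \<noteq> 0 \<longleftrightarrow> j = i + 1 \<or> i = j + 1 \<or> i = j \<and> i \<in> L"
    using A unfolding matrices_of_double_path by blast
  define a b c where "a = (\<lambda>i. A $$ (i - 1, i - 1))" "b = (\<lambda>i. A $$ (i - 1, i))" "c = (\<lambda>i. A $$ (i, i - 1))"
  have a: "a i = 0" if "i \<in> {1..n}" "odd i" for i
    using pat[OF that(1,1)] that(2) L(2) unfolding a_b_c_def by auto
  have b: "b i \<noteq> 0" and c: "c i \<noteq> 0" if "i \<in> {1..<n}" for i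
    using pat[of i "i + 1"] pat[of "i + 1" i] that unfolding a_b_c_def by auto
  \<comment> \<open>\<open>x k\<close> and \<open>y k\<close> are the values at vertex 2k+1; the
    recursions solve the null equations at vertex 2k+2. At odd vertices these equations are trivial.
    As n is odd, each even vertex has a right neighbour for the recursion to use.\<close>
  define x where "x = rec_nat 1 (\<lambda>k y. - (c (2 * k + 1) / b (2 * k + 2)) * y)"
  define y where "y = rec_nat 1 (\<lambda>k y. - (b (2 * k + 1) / c (2 * k + 2)) * y)"
  define v where "v i = (if odd i \<and> i \<le> n then x (i div 2) else 0)" for i
  define w where "w i = (if odd i \<and> i \<le> n then y (i div 2) else 0)" for i
  have v: "c (i - 1) * v (i - 1) + a i * v i + b i * v (i + 1) = 0" if i: "i \<in> {1..n}" for i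
  proof (cases "odd i")
    case False
    moreover have "i \<ge> 1" using i by simp
    ultimately have "\<exists>k. i = 2 * k + 2" by presburger
    then obtain k where k: "i = 2 * k + 2" by blast
    then have "2 * k + 3 \<le> n" using i n by auto presburger
    then show ?thesis using k b[of i] i by (simp add: v_def x_def)
  qed (use a i in \<open>auto simp: v_def\<close>)
  have w: "b (i - 1) * w (i - 1) + a i * w i + c i * w (i + 1) = 0" if i: "i \<in> {1..n}" for i
  proof (cases "odd i")
    case False
    moreover have "i \<ge> 1" using i by simp
    ultimately have "\<exists>k. i = 2 * k + 2" by presburger
    then obtain k where k: "i = 2 * k + 2" by blast
    then have "2 * k + 3 \<le> n" using i n by auto presburger
    then show ?thesis using k c[of i] i by (simp add: w_def y_def)
  qed (use a i in \<open>auto simp: w_def\<close>)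
  have "tri_centralizes n a b c (\<lambda>i j. v i * w j)"
    unfolding tri_centralizes_def
  proof (intro conjI allI impI ballI)
    show "v i * w j = 0" if "i \<notin> {1..n} \<or> j \<notin> {1..n}" for i j
      using that by (cases "i = 0"; cases "j = 0") (auto simp: v_def w_def)
    fix i j assume ij: "i \<in> {1..n}" "j \<in> {1..n}"
    have "c (i - 1) * (v (i - 1) * w j) + a i * (v i * w j) + b i * (v (i + 1) * w j) =
        (c (i - 1) * v (i - 1) + a i * v i + b i * v (i + 1)) * w j"
      by (simp add: algebra_simps)
    moreover have "b (j - 1) * (v i * w (j - 1)) + a j * (v i * w j) + c j * (v i * w (j + 1)) =
        (b (j - 1) * w (j - 1) + a j * w j + c j * w (j + 1)) * v i"
      by (simp add: algebra_simps)
    ultimately show "c (i - 1) * (v (i - 1) * w j) + a i * (v i * w j) + b i * (v (i + 1) * w j) =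
        b (j - 1) * (v i * w (j - 1)) + a j * (v i * w j) + c j * (v i * w (j + 1))"
      using v[OF ij(1)] w[OF ij(2)] by simp
  qed
  moreover have "path_free L (\<lambda>i j. v i * w j)"
    using L(2) by (auto simp: path_free_def v_def w_def)
  ultimately have "v 1 * w 1 = 0"
    using N has_nSSP_double_path_iff[OF A L(1)] unfolding a_b_c_def by blast
  moreover have "n \<ge> 1" using n by (cases n) auto
  ultimately show False by (simp add: v_def w_def x_def y_def)
qed

section \<open>Obstructions from reflection symmetry and from constant row sums\<close>

lemma tri_centralizes_diff:
  assumes "tri_centralizes n a b c Y" "tri_centralizes n a b c Z"
  shows "tri_centralizes n a b c (\<lambda>i j. Y i j - Z i j)"
  unfolding tri_centralizes_def
proof (intro conjI allI impI ballI)
  show "Y i j - Z i j = 0" if "i \<notin> {1..n} \<or> j \<notin> {1..n}" for i j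
    using assms that unfolding tri_centralizes_def by simp
  fix i j assume "i \<in> {1..n}" "j \<in> {1..n}"
  then have
    "c (i - 1) * Y (i - 1) j + a i * Y i j + b i * Y (i + 1) j =
        b (j - 1) * Y i (j - 1) + a j * Y i j + c j * Y i (j + 1)"
    "c (i - 1) * Z (i - 1) j + a i * Z i j + b i * Z (i + 1) j =
        b (j - 1) * Z i (j - 1) + a j * Z i j + c j * Z i (j + 1)"
    using assms unfolding tri_centralizes_def by blast+
  then show "c (i - 1) * (Y (i - 1) j - Z (i - 1) j) + a i * (Y i j - Z i j) + b i * (Y (i + 1) j - Z (i + 1) j) =
        b (j - 1) * (Y i (j - 1) - Z i (j - 1)) + a j * (Y i j - Z i j) + c j * (Y i (j + 1) - Z i (j + 1))"
    by (simp add: right_diff_distrib)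
qed

definition id_fun :: "nat \<Rightarrow> nat \<Rightarrow> nat \<Rightarrow> real" where
  "id_fun n i j = (if i \<in> {1..n} \<and> i = j then 1 else 0)"

definition reversal :: "nat \<Rightarrow> nat \<Rightarrow> nat \<Rightarrow> real" where
  "reversal n i j = (if i \<in> {1..n} \<and> j \<in> {1..n} \<and> i + j = n + 1 then 1 else 0)"

lemma tri_centralizes_id: "tri_centralizes n a (\<lambda>_. 1) (\<lambda>_. 1) (id_fun n)"
  unfolding tri_centralizes_def by (auto simp: id_fun_def)

lemma tri_centralizes_reversal:
  assumes sym: "\<And>i. i \<in> {1..n} \<Longrightarrow> a (n + 1 - i) = a i"
  shows "tri_centralizes n a (\<lambda>_. 1) (\<lambda>_. 1) (reversal n)"
  unfolding tri_centralizes_def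
proof (intro conjI allI impI ballI)
  show "reversal n i j = 0" if "i \<notin> {1..n} \<or> j \<notin> {1..n}" for i j
    using that by (auto simp: reversal_def)
  fix i j assume ij: "i \<in> {1..n}" "j \<in> {1..n}"
  have "a i = a j" if "i + j = n + 1"
  proof -
    have "n + 1 - i = j" using that by simp
    then show ?thesis using sym[OF ij(1)] by simp
  qed
  then show "1 * reversal n (i - 1) j + a i * reversal n i j + 1 * reversal n (i + 1) j =
      1 * reversal n i (j - 1) + a j * reversal n i j + 1 * reversal n i (j + 1)"
    using ij by (auto simp: reversal_def)
qed

text \<open>The reversal itself is the obstruction: for odd n its antidiagonal skips the positions
  next to the diagonal and meets the diagonal only at the loopless centre.\<close>

lemma not_requires_nSSP_symmetric_odd:
  assumes m: "m \<ge> 2" and n: "n = 2 * m - 1" and L: "L \<subseteq> {1..n}" "m \<notin> L"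
    and sym: "\<And>i. i \<in> {1..n} \<Longrightarrow> n + 1 - i \<in> L \<longleftrightarrow> i \<in> L"
  shows "\<not> requires_nSSP (double_path n L)"
proof (rule not_requires_nSSPI)
  show "tri_centralizes n (\<lambda>i. if i \<in> L then 1 else 0) (\<lambda>_. 1) (\<lambda>_. 1) (reversal n)"
    by (rule tri_centralizes_reversal) (simp only: sym)
  have "i + i = n + 1 \<longleftrightarrow> i = m" "i + (i + 1) \<noteq> n + 1" for i using m n by presburger+
  then show "path_free L (reversal n)"
    using L(2) by (auto simp: path_free_def reversal_def)
  show "reversal n 1 n \<noteq> 0" using m n by (simp add: reversal_def)
qed (use L in auto)

text \<open>Now the centre carries a loop, and subtracting the reversal from the identity cancels
  the entry there.\<close>

lemma not_requires_nSSP_centre_loop: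
  assumes m: "m \<ge> 2" and n: "n = 2 * m - 1"
  shows "\<not> requires_nSSP (double_path n {m})"
proof (rule not_requires_nSSPI)
  have "n + 1 - i = m \<longleftrightarrow> i = m" for i using m n by auto
  then show "tri_centralizes n (\<lambda>i. if i = m then 1 else 0) (\<lambda>_. 1) (\<lambda>_. 1)
      (\<lambda>i j. id_fun n i j - reversal n i j)"
    by (intro tri_centralizes_diff tri_centralizes_id tri_centralizes_reversal) simp
  have "i + (i + 1) \<noteq> n + 1" for i using m n by presburger
  then show "path_free {m} (\<lambda>i j. id_fun n i j - reversal n i j)"
    using m n by (auto simp: path_free_def reversal_def id_fun_def)
  have "n \<ge> 3" using m n by simp
  then show "id_fun n 1 n - reversal n 1 n \<noteq> 0" by (simp add: reversal_def id_fun_def)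
qed (use m n in auto)

text \<open>For even n the reversal \<open>J\<close> has ones next to the diagonal, so
  \<open>Y\<close> is \<open>A J\<close> instead. On the antidiagonal it carries the loop weights,
  nonzero only in the corners (1, n) and (n, 1). Its ones lie at positions with i + j even, hence
  never next to the diagonal, and meet the diagonal only at n/2 and n/2 + 1.\<close>

lemma not_requires_nSSP_end_loops_even:
  assumes n: "even n" "n \<ge> 4"
  shows "\<not> requires_nSSP (double_path n {1, n})"
proof (rule not_requires_nSSPI)
  define a :: "nat \<Rightarrow> real" where "a = (\<lambda>i. if i = 1 \<or> i = n then 1 else 0)"
  define Y :: "nat \<Rightarrow> nat \<Rightarrow> real" where "Y i j = (if i \<in> {1..n} \<and> j \<in> {1..n} then
      if i + j = n + 1 then a i else if i + j = n \<or> i + j = n + 2 then 1 else 0 else 0)" for i j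
  show "a i \<noteq> 0 \<longleftrightarrow> i \<in> {1, n}" for i by (simp add: a_def)
  show "tri_centralizes n a (\<lambda>_. 1) (\<lambda>_. 1) Y"
    unfolding tri_centralizes_def
  proof (intro conjI allI impI ballI)
    show "Y i j = 0" if "i \<notin> {1..n} \<or> j \<notin> {1..n}" for i j
      using that by (auto simp: Y_def)
    fix i j assume ij: "i \<in> {1..n}" "j \<in> {1..n}"
    consider "i + j < n" | "i + j = n" | "i + j = n + 1" | "i + j = n + 2" | "i + j > n + 2" by linarith
    then show "1 * Y (i - 1) j + a i * Y i j + 1 * Y (i + 1) j = 1 * Y i (j - 1) + a j * Y i j + 1 * Y i (j + 1)"
      by cases (use ij n in \<open>auto simp: Y_def a_def\<close>)
  qed
  have "Y i (i + 1) = 0" "Y (i + 1) i = 0" for i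
  proof -
    have "i + (i + 1) \<noteq> n" "i + (i + 1) \<noteq> n + 2" using n by presburger+
    then show "Y i (i + 1) = 0" "Y (i + 1) i = 0" using n by (auto simp: Y_def a_def)
  qed
  moreover have "Y 1 1 = 0" "Y n n = 0" using n by (auto simp: Y_def)
  ultimately show "path_free {1, n} Y" by (auto simp: path_free_def)
  show "Y 1 (n - 1) \<noteq> 0" using n by (simp add: Y_def)
qed (use n in auto)

lemma not_requires_nSSP_interior_loops:
  assumes n: "n \<ge> 3"
  shows "\<not> requires_nSSP (double_path n ({1..n} - {1, n}))"
proof (rule not_requires_nSSPI)
  define a :: "nat \<Rightarrow> real" where "a = (\<lambda>i. if i = 1 \<or> i = n then 0 else -1)"
  define A :: "nat \<Rightarrow> nat \<Rightarrow> real" where "A i j = (if i \<in> {1..n} \<and> j \<in> {1..n} then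
      if i = j then a i else if j = i + 1 \<or> i = j + 1 then 1 else 0 else 0)" for i j
  define J :: "nat \<Rightarrow> nat \<Rightarrow> real" where "J i j = (if i \<in> {1..n} \<and> j \<in> {1..n} then 1 else 0)" for i j
  \<comment> \<open>All row and column sums of \<open>A\<close> are 1, so it commutes with the all-ones matrix \<open>J\<close>.\<close>
  let ?Y = "\<lambda>i j. J i j - A i j - id_fun n i j - id_fun n i j"
  show "a i \<noteq> 0 \<longleftrightarrow> i \<in> {1..n} - {1, n}" if "i \<in> {1..n}" for i using that by (auto simp: a_def)
  have "tri_centralizes n a (\<lambda>_. 1) (\<lambda>_. 1) J"
    unfolding tri_centralizes_def using n by (auto simp: J_def a_def)
  moreover have "tri_centralizes n a (\<lambda>_. 1) (\<lambda>_. 1) A"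
    unfolding tri_centralizes_def
  proof (intro conjI allI impI ballI)
    show "A i j = 0" if "i \<notin> {1..n} \<or> j \<notin> {1..n}" for i j
      using that by (auto simp: A_def)
    fix i j assume ij: "i \<in> {1..n}" "j \<in> {1..n}"
    consider "i + 1 < j" | "j = i + 1" | "i = j" | "i = j + 1" | "i > j + 1" by linarith
    then show "1 * A (i - 1) j + a i * A i j + 1 * A (i + 1) j = 1 * A i (j - 1) + a j * A i j + 1 * A i (j + 1)"
      by cases (use ij in \<open>auto simp: A_def\<close>)
  qed
  ultimately show "tri_centralizes n a (\<lambda>_. 1) (\<lambda>_. 1) ?Y"
    by (intro tri_centralizes_diff tri_centralizes_id)
  \<comment> \<open>Next to the diagonal \<open>J\<close> and \<open>A\<close> are both 1. At a loop
    \<open>J - A\<close> is 1 - (-1) = 2, which the two copies of the identity cancel; at (1, 1) the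
    value -1 survives.\<close>
  show "path_free ({1..n} - {1, n}) ?Y"
    by (auto simp: path_free_def J_def A_def a_def id_fun_def)
  show "?Y 1 1 \<noteq> 0" using n by (simp add: J_def A_def a_def id_fun_def)
qed auto

section \<open>Explicit matrices with the nSSP\<close>

text \<open>Only the central diagonal entry \<open>d\<close> of \<open>Y\<close> is not zero by
  assumption. Computing the second superdiagonal from both ends gives two values for its entry at
  (m-1, m+1), namely d/2 and d, so \<open>d = 0\<close> and \<open>diag_zero_imp_zero\<close>
  applies.\<close>

lemma allows_nSSP_complement_of_centre:
  assumes m: "m \<ge> 2" and n: "n = 2 * m - 1"
  shows "allows_nSSP (double_path n ({1..n} - {m}))"
proof -
  \<comment> \<open>Unequal weights next to the centre: for equal ones the reversal would be an obstruction.\<close>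
  define c :: "nat \<Rightarrow> real" where "c = (\<lambda>i. if i = m then 2 else 1)"
  show ?thesis
  proof (rule allows_nSSPI)
    show "(if i \<in> {1..n} - {m} then 1 else 0 :: real) \<noteq> 0 \<longleftrightarrow> i \<in> {1..n} - {m}" for i by simp
    show "c i \<noteq> 0" for i by (simp add: c_def)
    fix Y i j
    assume Y: "tri_centralizes n (\<lambda>i. if i \<in> {1..n} - {m} then 1 else 0) (\<lambda>_. 1) c Y"
      and free: "path_free ({1..n} - {m}) Y"
    define d where "d = Y m m"
    define a :: "nat \<Rightarrow> real" where "a = (\<lambda>i. if i \<in> {1..n} - {m} then 1 else 0)"
    have Y': "tri_centralizes n a (\<lambda>_. 1) c Y" using Y unfolding a_def .
    have supp: "\<And>i j. i \<notin> {1..n} \<or> j \<notin> {1..n} \<Longrightarrow> Y i j = 0"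
      and comm: "\<And>i j. i \<in> {1..n} \<Longrightarrow> j \<in> {1..n} \<Longrightarrow>
        c (i - 1) * Y (i - 1) j + a i * Y i j + Y (i + 1) j =
        Y i (j - 1) + a j * Y i j + c j * Y i (j + 1)"
      using Y' unfolding tri_centralizes_def by simp_all
    have off: "\<And>i. Y i (i + 1) = 0"
      using free unfolding path_free_def by auto
    have diag: "Y i i = (if i = m then d else 0)" for i
    proof (cases "i \<in> {1..n}")
      case True
      then show ?thesis using free unfolding path_free_def by (auto simp: d_def)
    next
      case False
      then show ?thesis using supp m n by auto
    qed
    \<comment> \<open>In the equation at (i, i+1) the loop weights multiply zeros, leaving a
      recursion along the second superdiagonal with \<open>d\<close> as its only source
      term.\<close>
    have second: "c (i - 1) * Y (i - 1) (i + 1) + (if i + 1 = m then d else 0) =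
        (if i = m then d else 0) + c (i + 1) * Y i (i + 2)" if "1 \<le> i" "i < n" for i
    proof -
      have "i \<in> {1..n}" "i + 1 \<in> {1..n}" using that by auto
      from comm[OF this] show ?thesis using off diag[of i] diag[of "i + 1"] by simp
    qed
    have left: "Y i (i + 2) = 0" if "i + 1 < m" for i
      using that
    proof (induction i)
      case (Suc i)
      then show ?case using second[of "Suc i"] n by (simp add: c_def)
    qed (use supp in simp)
    have right: "Y i (i + 2) = 0" if "m \<le> i" for i
    proof (cases "i \<le> n")
      case True
      then show ?thesis using that
      proof (induction i rule: inc_induct)
        case (step k)
        then show ?case using second[of "k + 1"] supp m
          by (cases "k + 1 < n") (auto simp: c_def split: if_splits)
      qed (use supp in auto)
    qed (use supp in auto)
    have "d = 2 * Y (m - 1) (m + 1)"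
    proof (cases "m = 2")
      case True
      then show ?thesis using second[of 1] n supp[of 0] by (simp add: c_def numeral_eq_Suc)
    next
      case False
      then obtain k where "m = k + 3" using m by (metis add.commute le_Suc_ex le_antisym not_less_eq_eq numeral_2_eq_2 numeral_3_eq_3)
      then show ?thesis using second[of "k + 2"] left[of "k + 1"] n
        by (simp add: c_def numeral_3_eq_3)
    qed
    moreover have "Y (m - 1) (m + 1) = d"
    proof -
      have "m < n" "m - 1 \<noteq> m" using m n by linarith+
      then show ?thesis using second[of m] right[of m] m by (simp add: c_def)
    qed
    ultimately have "d = 0" by simp
    then show "Y i j = 0"
      using diag_zero_imp_zero[OF Y _ _ free] diag by (simp add: c_def)
  qed auto
qed

text \<open>Away from the loops the equation is a discrete wave equation,
  \<open>Y (i - 1) j + Y (i + 1) j = Y i (j - 1) + Y i (j + 1)\<close>. The weight 1 at vertex 1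
  acts like a reflecting border, as if row 0 repeated row 1, so the upper triangle is explicit in
  the diagonal \<open>d\<close>. The last column then forces \<open>d = 0\<close>.\<close>

lemma allows_nSSP_two_end_loops:
  assumes n: "n \<ge> 3"
  shows "allows_nSSP (double_path n {1, n})"
proof -
  \<comment> \<open>With equal end weights, \<open>J\<close> (for odd n) or \<open>A J\<close> (for
    even n) would be an obstruction.\<close>
  define a :: "nat \<Rightarrow> real" where "a = (\<lambda>i. if i = 1 then 1 else if i = n then 2 else 0)"
  show ?thesis
  proof (rule allows_nSSPI)
    show "a i \<noteq> 0 \<longleftrightarrow> i \<in> {1, n}" for i by (simp add: a_def)
    fix Y i j
    assume Y: "tri_centralizes n a (\<lambda>_. 1) (\<lambda>_. 1) Y" and free: "path_free {1, n} Y"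
    define d where "d i = Y i i" for i
    have supp: "\<And>i j. i \<notin> {1..n} \<or> j \<notin> {1..n} \<Longrightarrow> Y i j = 0"
      and comm: "\<And>i j. i \<in> {1..n} \<Longrightarrow> j \<in> {1..n} \<Longrightarrow>
        Y (i - 1) j + a i * Y i j + Y (i + 1) j = Y i (j - 1) + a j * Y i j + Y i (j + 1)"
      using Y unfolding tri_centralizes_def by simp_all
    have off: "\<And>i. Y i (i + 1) = 0" and d: "d 1 = 0" "d n = 0"
      using free unfolding path_free_def d_def by auto
    \<comment> \<open>The solution of the recursion for the entries \<open>Y i (i + k)\<close> given by the left boundary alone;
      the right boundary has a different loop weight, which forces \<open>d = 0\<close>.\<close>
    define e where "e i k = (if even k then d (i + k div 2) else d (k div 2 + 1))" for i k :: nat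
    have "\<forall>i. 1 \<le> i \<longrightarrow> (i + k \<le> n \<longrightarrow> Y i (i + k) = e i k) \<and>
        (i + k + 1 \<le> n \<longrightarrow> Y i (i + k + 1) = e i (k + 1))" for k
    proof (induction k)
      case 0
      then show ?case using off d by (simp add: e_def d_def)
    next
      case (Suc k)
      have E0: "Y i j = e i k" if "1 \<le> i" "j = i + k" "j \<le> n" for i j using Suc that by blast
      have E1: "Y i j = e i (k + 1)" if "1 \<le> i" "j = i + k + 1" "j \<le> n" for i j using Suc that by blast
      have "i + k + 2 \<le> n \<Longrightarrow> Y i (i + k + 2) = e i (k + 2)" if "1 \<le> i" for i
        using that
      proof (induction i rule: dec_induct)
        case base
        have "Y 0 (k + 2) = 0" by (intro supp) simp
        moreover have "Y 1 (k + 2) = e 1 (k + 1)" by (intro E1) (use base in simp_all)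
        moreover have "Y (1 + 1) (k + 2) = e (1 + 1) k" "Y 1 (k + 1) = e 1 k"
          by (intro E0; use base in simp)+
        moreover have "Y 0 (k + 2) + a 1 * Y 1 (k + 2) + Y (1 + 1) (k + 2) =
            Y 1 (k + 1) + a (k + 2) * Y 1 (k + 2) + Y 1 (k + 3)"
          using comm[of 1 "k + 2"] base by (simp add: eval_nat_numeral)
        moreover have "a 1 = 1" "a (k + 2) = 0" using base n by (auto simp: a_def)
        ultimately have "Y 1 (k + 3) = e 1 (k + 1) + e (1 + 1) k - e 1 k" by simp
        also have "\<dots> = e 1 (k + 2)" by (auto simp: e_def)
        finally show ?case by (simp add: numeral_3_eq_3)
      next
        case (step i)
        have "Y i (i + k + 2) = e i (k + 2)" using step by simp
        moreover have "Y (i + 2) (i + k + 2) = e (i + 2) k" "Y (i + 1) (i + k + 1) = e (i + 1) k"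
          by (intro E0; use step in simp)+
        moreover have "Y i (i + k + 2) + a (i + 1) * Y (i + 1) (i + k + 2) + Y (i + 2) (i + k + 2) =
            Y (i + 1) (i + k + 1) + a (i + k + 2) * Y (i + 1) (i + k + 2) + Y (i + 1) (i + k + 3)"
          using comm[of "i + 1" "i + k + 2"] step by (simp add: eval_nat_numeral)
        moreover have "a (i + 1) = 0" "a (i + k + 2) = 0" using step by (auto simp: a_def)
        ultimately have "Y (i + 1) (i + k + 3) = e i (k + 2) + e (i + 2) k - e (i + 1) k" by simp
        also have "\<dots> = e (i + 1) (k + 2)" by (auto simp: e_def)
        finally show ?case by (simp add: numeral_3_eq_3)
      qed
      then show ?case using Suc by simp
    qed
    then have Ye: "Y i j = e i (j - i)" if "1 \<le> i" "i \<le> j" "j \<le> n" for i j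
      using that by (metis le_add_diff_inverse)
    have right: "e (i - 1) (n - i + 1) + e (i + 1) (n - i - 1) = e i (n - i - 1) + 2 * e i (n - i)"
      if "1 < i" "i < n" for i
      using comm[of i n] that Ye[of "i - 1" n] Ye[of "i + 1" n] Ye[of i "n - 1"] Ye[of i n] supp[of i "n + 1"]
      by (simp add: a_def Suc_diff_le)
    \<comment> \<open>The last-column equation in row i couples the mirror entries
      \<open>d (r + 1)\<close> and \<open>d (n - r)\<close>: for n - i = 2r the first is twice the
      second, for n - i = 2r + 1 the second is twice the first. Together they force both to
      vanish.\<close>
    have ev: "d (r + 1) = 2 * d (n - r)" if "1 \<le> r" "2 * r + 2 \<le> n" for r
    proof -
      define q i where "q = r - 1" and "i = n - 2 * r"
      have qi: "r = q + 1" "1 < i" "i < n" "n - i = 2 * q + 2" "n - r = i + q + 1"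
        using that unfolding q_def i_def by linarith+
      have "e (i - 1) (2 * q + 3) + e (i + 1) (2 * q + 1) = e i (2 * q + 1) + 2 * e i (2 * q + 2)"
        using right[OF qi(2,3)] qi(4) by (simp add: numeral_3_eq_3)
      then show ?thesis using qi by (simp add: e_def)
    qed
    have od: "d (n - r) = 2 * d (r + 1)" if "2 * r + 3 \<le> n" for r
    proof -
      define i where "i = n - (2 * r + 1)"
      have i: "1 < i" "i < n" "n - i = 2 * r + 1" "n - r = i + r + 1" "i - 1 + (r + 1) = i + r"
        using that unfolding i_def by linarith+
      have "e (i - 1) (2 * r + 2) + e (i + 1) (2 * r) = e i (2 * r) + 2 * e i (2 * r + 1)"
        using right[OF i(1,2)] i(3) by simp
      then show ?thesis using i by (simp add: e_def)
    qed
    \<comment> \<open>The relation \<open>od\<close> stops short of the middle of the diagonal; the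
      corner equation, in which both loop weights enter, supplies what is missing there.\<close>
    have corner: "Y 1 n + Y 2 n = Y 1 (n - 1) + 2 * Y 1 n"
      using comm[of 1 n] n supp[of 0] supp[of 1 "n + 1"] by (simp add: a_def numeral_2_eq_2)
    then have corner: "e 2 (n - 2) = e 1 (n - 2) + e 1 (n - 1)"
      using Ye[of 1 n] Ye[of 2 n] Ye[of 1 "n - 1"] n by (simp add: numeral_2_eq_2)
    have outer: "d (r + 1) = 0 \<and> d (n - r) = 0" if "2 * r + 3 \<le> n" for r
      using ev[of r] od[of r] d that by (cases "r = 0") auto
    have inner: "d (r + 1) = 0 \<and> d (n - r) = 0" if r: "n = 2 * r + 1 \<or> n = 2 * r + 2" for r
      using r
    proof
      assume "n = 2 * r + 1"
      then show ?thesis using corner n by (cases r) (auto simp: e_def)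
    next
      assume r: "n = 2 * r + 2"
      then have "n - r = r + 2" "e 2 (n - 2) = d (r + 2)" "e 1 (n - 2) = d (r + 1)" "e 1 (n - 1) = d (r + 1)"
        by (auto simp: e_def)
      then show ?thesis using ev[of r] corner r n by simp
    qed
    have d0: "d (r + 1) = 0 \<and> d (n - r) = 0" if "2 * r + 1 \<le> n" for r
    proof -
      have "2 * r + 3 \<le> n \<or> n = 2 * r + 1 \<or> n = 2 * r + 2" using that by linarith
      then show ?thesis using outer inner by blast
    qed
    have "d i = 0" for i
    proof (cases "i \<in> {1..n}")
      case True
      show ?thesis
      proof (cases "2 * i \<le> n + 1")
        case True
        then show ?thesis using d0[of "i - 1"] \<open>i \<in> {1..n}\<close> by simp
      next
        case False
        then show ?thesis using d0[of "n - i"] \<open>i \<in> {1..n}\<close> by simp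
      qed
    qed (use supp in \<open>auto simp: d_def\<close>)
    then show "Y i j = 0"
      using diag_zero_imp_zero[OF Y _ _ free] by (simp add: d_def)
  qed (use n in auto)
qed

section \<open>Assembly of the cases\<close>

theorem theorem5p7:
  fixes n :: nat
  assumes "n > 0"
  shows
    "(n \<ge> 3 \<longrightarrow> (\<forall>L. L = {1, n} \<longrightarrow>
        \<not> requires_nSSP (double_path n L) \<and> allows_nSSP (double_path n L) \<and>
        \<not> requires_nSSP (double_path n ({1..n} - L)))) \<and>
     (even n \<longrightarrow> requires_nSSP (double_path n {2})) \<and>
     (n \<ge> 3 \<and> odd n \<longrightarrow>
        (\<forall>L. L = {(n + 1) div 2} \<longrightarrow> \<not> requires_nSSP (double_path n L)) \<and>
        (\<forall>L. L = {1..n} - {(n + 1) div 2} \<longrightarrow>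
           \<not> requires_nSSP (double_path n L) \<and> allows_nSSP (double_path n L)) \<and>
        (\<forall>L. L \<subseteq> {2 * i | i. i \<in> {1..(n - 1) div 2}} \<longrightarrow>
           \<not> allows_nSSP (double_path n L)))"
proof (intro conjI impI allI)
  assume n: "n \<ge> 3"
  fix L assume L: "L = {1, n}"
  show "\<not> requires_nSSP (double_path n L)"
  proof (cases "even n")
    case True
    then have "n \<ge> 4" using n by presburger
    then show ?thesis using True L not_requires_nSSP_end_loops_even by simp
  next
    case False
    then obtain k where k: "n = 2 * k + 1" by (elim oddE)
    show ?thesis unfolding L
      by (rule not_requires_nSSP_symmetric_odd[of "k + 1"]) (use k n in auto)
  qed
  show "allows_nSSP (double_path n L)" unfolding L by (rule allows_nSSP_two_end_loops[OF n])
  show "\<not> requires_nSSP (double_path n ({1..n} - L))"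
    unfolding L by (rule not_requires_nSSP_interior_loops[OF n])
next
  assume "even n"
  then show "requires_nSSP (double_path n {2})" using assms by (rule requires_nSSP_double_path_2)
next
  assume "n \<ge> 3 \<and> odd n"
  moreover define m where "m = (n + 1) div 2"
  ultimately have m: "m = (n + 1) div 2" "m \<ge> 2" "n = 2 * m - 1" by presburger+
  fix L
  show "\<not> requires_nSSP (double_path n L)" if "L = {(n + 1) div 2}"
    unfolding that m(1)[symmetric] by (rule not_requires_nSSP_centre_loop[OF m(2,3)])
  show "\<not> requires_nSSP (double_path n L)" if "L = {1..n} - {(n + 1) div 2}"
    unfolding that m(1)[symmetric]
    by (rule not_requires_nSSP_symmetric_odd[OF m(2,3)]) (use m(2,3) in auto)
  show "allows_nSSP (double_path n L)" if "L = {1..n} - {(n + 1) div 2}"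
    unfolding that m(1)[symmetric] by (rule allows_nSSP_complement_of_centre[OF m(2,3)])
  show "\<not> allows_nSSP (double_path n L)" if L: "L \<subseteq> {2 * i | i. i \<in> {1..(n - 1) div 2}}"
  proof (rule not_allows_nSSP_even_loops)
    show "odd n" using m(2,3) by simp
    show "L \<subseteq> {1..n}" using L by auto
    show "even l" if "l \<in> L" for l using that L by auto
  qed
qed

end
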